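(* Let $\mathbb{P},\mathbb{Q}$ be probability distributions on $\mathbb{R}^N$ with likelihood ratio $L=\frac{d\mathbb{P}}{d\mathbb{Q}}$. For any low-degree test $\Psi\in\mathcal{T}_{\tau,D,K}$ we have $$\mathbb{Q}(\Psi\text{ fails})+\mathbb{P}(\Psi\text{ fails})\ge 1-\sqrt K\sqrt{\|L^{\le D}\|^2-1}-(\sqrt\tau+2\sqrt K)\sqrt\tau .$$ In particular, for sequences $\mathbb{P}=\mathbb{P}_n$, $\mathbb{Q}=\mathbb{Q}_n$, $N=N_n$, $D=D_n$, $\tau=\tau_n$, $K=K_n$ and $\Psi=\Psi_n\in\mathcal{T}_{\tau_n,D_n,K_n}$: if $\|L_n^{\le D}\|=1+o(1)$, $\tau_n=o(1)$ and $K_n=O(1)$ as $n\to\infty$, then $$\mathbb{Q}_n(\Psi\text{ fails})+\mathbb{P}_n(\Psi\text{ fails})\ge1-o(1).$$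
   Context: Testing problem: $H_0: X\sim\mathbb{Q}$ against $H_1: X\sim\mathbb{P}$, for data $X\in\mathbb{R}^N$. $L^{\le D}$ denotes the orthogonal projection, with respect to the inner product $\langle f,g\rangle=\mathbb{E}_{X\sim\mathbb{Q}}[f(X)g(X)]$ of $L^2(\mathbb{Q})$, of $L$ onto the space of polynomials $\mathbb{R}^N\to\mathbb{R}$ of degree at most $D$, and $\|L^{\le D}\|^2=\mathbb{E}_{\mathbb{Q}}(L^{\le D})^2$; equivalently $\|L^{\le D}\|=\max_{\deg f\le D}\mathbb{E}_{\mathbb{P}}[f]/\sqrt{\mathbb{E}_{\mathbb{Q}}[f^2]}$. In the asymptotic setting, $L_n^{\le D}$ is the corresponding object for $\mathbb{P}_n,\mathbb{Q}_n$. Given a polynomial $f:\mathbb{R}^N\to\mathbb{R}$, the randomized test $\Psi_f$ is: if $f(X)\in[0,1]$, then $\Psi_f(X)=B(f(X))$, a Bernoulli random variable with success probability $f(X)$ (given $X$); otherwise $\Psi_f(X)=\perp$. The test $\Psi_f$ fails if it outputs $1$ under $H_0$, outputs $0$ under $H_1$, or outputs $\perp$; thus $\mathbb{Q}(\Psi\text{ fails})=\mathbb{Q}(\Psi\in\{1,\perp\})$ and $\mathbb{P}(\Psi\text{ fails})=\mathbb{P}(\Psi\in\{0,\perp\})$. Define $$\mathcal{T}_{\tau,D,K}=\{\Psi=\Psi_f:\ \deg(f)\le D,\ \max(\mathbb{E}_{\mathbb{Q}}f^2,\mathbb{E}_{\mathbb{P}}f^2)\le K,\ \max(\mathbb{Q}(f\notin[0,1]),\mathbb{P}(f\notin[0,1]))\le\tau\}.$$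 *)

theory Defs
  imports "HOL-Probability.Probability"
begin

text \<open>
  Since the dimension \<open>N\<close> varies along the sequences of the asymptotic statement, \<open>\<real>\<^sup>N\<close> is the product
  of copies of \<open>\<real>\<close> indexed by \<open>{..<N}\<close> with its product (= Borel) sigma-algebra, whose points are extensional functions
  \<open>nat \<Rightarrow> real\<close>.
\<close>

definition distribution_on :: "nat \<Rightarrow> (nat \<Rightarrow> real) measure \<Rightarrow> bool" where
  "distribution_on N M \<longleftrightarrow>
     prob_space M \<and> sets M = sets (PiM {..<N} (\<lambda>_. borel :: real measure))"

definition multi_indices :: "nat \<Rightarrow> nat \<Rightarrow> (nat \<Rightarrow> nat) set" where
  "multi_indices N D = {\<alpha> \<in> {..<N} \<rightarrow>\<^sub>E UNIV. (\<Sum>i<N. \<alpha> i) \<le> D}"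

lemma finite_multi_indices: "finite (multi_indices N D)"
proof (rule finite_subset)
  show "multi_indices N D \<subseteq> {..<N} \<rightarrow>\<^sub>E {..D}"
  proof
    fix \<alpha> assume *: "\<alpha> \<in> multi_indices N D"
    have "\<alpha> i \<le> D" if "i < N" for i
      using * that member_le_sum[of i "{..<N}" \<alpha>] by (auto simp: multi_indices_def)
    with * show "\<alpha> \<in> {..<N} \<rightarrow>\<^sub>E {..D}"
      by (auto simp: multi_indices_def PiE_def)
  qed
qed (intro finite_PiE; simp)

definition polys :: "nat \<Rightarrow> nat \<Rightarrow> ((nat \<Rightarrow> real) \<Rightarrow> real) set" where
  "polys N D =
     {f. \<exists>c. f = (\<lambda>x. \<Sum>\<alpha>\<in>multi_indices N D. c \<alpha> * (\<Prod>i<N. x i ^ \<alpha> i))}"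

definition L2_inner :: "'a measure \<Rightarrow> ('a \<Rightarrow> real) \<Rightarrow> ('a \<Rightarrow> real) \<Rightarrow> real" where
  "L2_inner Q f g = (\<integral>x. f x * g x \<partial>Q)"

definition L2_norm :: "'a measure \<Rightarrow> ('a \<Rightarrow> real) \<Rightarrow> real" where
  "L2_norm Q f = sqrt (L2_inner Q f f)"

definition likelihood_ratio :: "'a measure \<Rightarrow> 'a measure \<Rightarrow> 'a \<Rightarrow> real" where
  "likelihood_ratio Q P x = enn2real (RN_deriv Q P x)"

text \<open>
  The polynomials of degree at most \<open>D\<close> for which the inner products needed to project \<open>L\<close> exist
  (the Bochner integral of a non-integrable function is \<open>0\<close>, so this has to be said). Under the
  usual standing assumption that \<open>L\<close> and all these polynomials lie in \<open>L\<^sup>2(Q)\<close> both conditions hold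
  automatically and this is all of \<open>polys N D\<close>, see \<open>low_degree_space_eq_polys\<close> below.
\<close>

definition low_degree_space ::
    "nat \<Rightarrow> nat \<Rightarrow> (nat \<Rightarrow> real) measure \<Rightarrow> ((nat \<Rightarrow> real) \<Rightarrow> real) \<Rightarrow> ((nat \<Rightarrow> real) \<Rightarrow> real) set" where
  "low_degree_space N D Q L =
     {f \<in> polys N D. integrable Q (\<lambda>x. (f x)\<^sup>2) \<and> integrable Q (\<lambda>x. L x * f x)}"

lemma polys_measurable:
  assumes "f \<in> polys N D"
  shows "f \<in> borel_measurable (PiM {..<N} (\<lambda>_. borel :: real measure))"
proof -
  obtain c where f: "f = (\<lambda>x. \<Sum>\<alpha>\<in>multi_indices N D. c \<alpha> * (\<Prod>i<N. x i ^ \<alpha> i))"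
    using assms by (auto simp: polys_def)
  have "(\<lambda>x. x i) \<in> borel_measurable (PiM {..<N} (\<lambda>_. borel :: real measure))" if "i < N" for i
    using that by (intro measurable_component_singleton) auto
  then show ?thesis
    unfolding f
    by (intro borel_measurable_sum borel_measurable_times borel_measurable_const
          borel_measurable_prod borel_measurable_power) auto
qed

lemma low_degree_space_eq_polys:
  assumes Q: "distribution_on N Q"
    and L: "L \<in> borel_measurable Q" "integrable Q (\<lambda>x. (L x)\<^sup>2)"
    and polys: "\<And>f. f \<in> polys N D \<Longrightarrow> integrable Q (\<lambda>x. (f x)\<^sup>2)"
  shows "low_degree_space N D Q L = polys N D"
proof -
  have "integrable Q (\<lambda>x. L x * f x)" if f: "f \<in> polys N D" for f
  proof (rule Bochner_Integration.integrable_bound)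
    show "integrable Q (\<lambda>x. (L x)\<^sup>2 + (f x)\<^sup>2)"
      using L polys[OF f] by simp
    have "f \<in> borel_measurable Q"
      using polys_measurable[OF f] Q by (simp add: distribution_on_def cong: measurable_cong_sets)
    then show "(\<lambda>x. L x * f x) \<in> borel_measurable Q"
      using L by simp
    have "\<bar>a * b\<bar> \<le> a\<^sup>2 + b\<^sup>2" for a b :: real
    proof -
      have "0 \<le> (\<bar>a\<bar> - \<bar>b\<bar>)\<^sup>2" "0 \<le> \<bar>a\<bar> * \<bar>b\<bar>" by simp_all
      then show ?thesis unfolding power2_diff power2_abs abs_mult by linarith
    qed
    then show "AE x in Q. norm (L x * f x) \<le> norm ((L x)\<^sup>2 + (f x)\<^sup>2)"
      by simp
  qed
  with polys show ?thesis by (auto simp: low_degree_space_def)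
qed

text \<open>
  The orthogonal projection \<open>L\<^sup>\<le>\<^sup>D\<close>. It is determined only up to \<open>Q\<close>-null sets, hence a choice of
  representative.
\<close>

definition low_degree_proj ::
    "nat \<Rightarrow> nat \<Rightarrow> (nat \<Rightarrow> real) measure \<Rightarrow> ((nat \<Rightarrow> real) \<Rightarrow> real) \<Rightarrow> (nat \<Rightarrow> real) \<Rightarrow> real" where
  "low_degree_proj N D Q L =
     (SOME g. g \<in> low_degree_space N D Q L \<and>
        (\<forall>f\<in>low_degree_space N D Q L. L2_inner Q (\<lambda>x. L x - g x) f = 0))"

definition low_degree_norm ::
    "nat \<Rightarrow> nat \<Rightarrow> (nat \<Rightarrow> real) measure \<Rightarrow> (nat \<Rightarrow> real) measure \<Rightarrow> real" where
  "low_degree_norm N D Q P = L2_norm Q (low_degree_proj N D Q (likelihood_ratio Q P))"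

text \<open>
  A randomized test maps the data to the conditional law of its output; the outputs \<open>0\<close>, \<open>1\<close>, \<open>\<bottom>\<close> are
  \<open>Some False\<close>, \<open>Some True\<close>, \<open>None\<close>.
\<close>

type_synonym rtest = "(nat \<Rightarrow> real) \<Rightarrow> bool option pmf"

definition test_of :: "((nat \<Rightarrow> real) \<Rightarrow> real) \<Rightarrow> rtest" where
  "test_of f x =
     (if f x \<in> {0..1} then map_pmf Some (bernoulli_pmf (f x)) else return_pmf None)"

definition output_law :: "(nat \<Rightarrow> real) measure \<Rightarrow> rtest \<Rightarrow> bool option measure" where
  "output_law M \<Psi> = M \<bind> (\<lambda>x. measure_pmf (\<Psi> x))"

definition fails_null :: "(nat \<Rightarrow> real) measure \<Rightarrow> rtest \<Rightarrow> real" where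
  "fails_null Q \<Psi> = measure (output_law Q \<Psi>) {Some True, None}"

definition fails_alt :: "(nat \<Rightarrow> real) measure \<Rightarrow> rtest \<Rightarrow> real" where
  "fails_alt P \<Psi> = measure (output_law P \<Psi>) {Some False, None}"

definition low_degree_tests ::
    "nat \<Rightarrow> (nat \<Rightarrow> real) measure \<Rightarrow> (nat \<Rightarrow> real) measure \<Rightarrow> real \<Rightarrow> nat \<Rightarrow> real \<Rightarrow> rtest set" where
  "low_degree_tests N Q P \<tau> D K =
     {\<Psi>. \<exists>f. \<Psi> = test_of f \<and> f \<in> polys N D \<and>
        integrable Q (\<lambda>x. (f x)\<^sup>2) \<and> integrable P (\<lambda>x. (f x)\<^sup>2) \<and>
        max (\<integral>x. (f x)\<^sup>2 \<partial>Q) (\<integral>x. (f x)\<^sup>2 \<partial>P) \<le> K \<and>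
        max (measure Q {x \<in> space Q. f x \<notin> {0..1}})
            (measure P {x \<in> space P. f x \<notin> {0..1}}) \<le> \<tau>}"

end

theory Submission
  imports Defs "HOL-Library.Function_Algebras"
begin

text \<open>
  Let \<open>f\<close> be the polynomial of the test, \<open>A\<close> the event \<open>f \<notin> [0,1]\<close>, and \<open>g\<close> the projection \<open>L\<^sup>\<le>\<^sup>D\<close>.
  Averaging the Bernoulli coin, a test fails under \<open>Q\<close> with probability
  \<open>E\<^sub>Q f - E\<^sub>Q[f 1\<^sub>A] + Q(A)\<close> and under \<open>P\<close> with probability \<open>1 - E\<^sub>P f + E\<^sub>P[f 1\<^sub>A]\<close>, the mass of \<open>A\<close>
  being absorbed in the \<open>1\<close> in the second case. So the sum of the two is at least
  \<open>1 - (E\<^sub>P f - E\<^sub>Q f) - \<bar>E\<^sub>Q[f 1\<^sub>A]\<bar> - \<bar>E\<^sub>P[f 1\<^sub>A]\<bar>\<close>. By Cauchy--Schwarz each of the last two terms is at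
  most \<open>\<surd>K \<surd>\<tau>\<close> (\<open>integral_outside_le\<close>). Since \<open>f\<close> has degree at most \<open>D\<close>, integrating it against \<open>L\<close> is
  the same as integrating it against \<open>g\<close>, so \<open>E\<^sub>P f - E\<^sub>Q f = E\<^sub>Q[(g - 1) f] \<le> \<parallel>g - 1\<parallel> \<surd>K\<close>; and as
  the constant \<open>1\<close> is itself a polynomial of degree at most \<open>D\<close>, \<open>E\<^sub>Q g = E\<^sub>P 1 = 1\<close>, whence
  \<open>\<parallel>g - 1\<parallel>\<^sup>2 = \<parallel>g\<parallel>\<^sup>2 - 1\<close> (\<open>low_degree_advantage\<close>). In the asymptotic regime the error terms of this
  bound are products of a bounded and a vanishing factor.

  The step that takes work is that \<open>g\<close> has the defining property of a projection at all: \<open>L\<close> may fail to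
  be square integrable, hence to be a vector of \<open>L\<^sup>2(Q)\<close>, and the space onto which it is projected
  consists only of those polynomials for which the inner products exist. That space is still finite
  dimensional, and \<open>f \<mapsto> E\<^sub>P f\<close> is a linear functional on it which vanishes on \<open>Q\<close>-null polynomials, because
  \<open>P\<close> is absolutely continuous. The existence of \<open>g\<close> is therefore a finite-dimensional Riesz theorem for
  a possibly degenerate inner product (\<open>degenerate_Riesz\<close>).
\<close>

section \<open>Square integrable functions\<close>

lemma abs_mult_le_sum_squares: "\<bar>a * b\<bar> \<le> a\<^sup>2 + b\<^sup>2" for a b :: real
proof -
  have "0 \<le> (\<bar>a\<bar> - \<bar>b\<bar>)\<^sup>2" "0 \<le> \<bar>a\<bar> * \<bar>b\<bar>" by simp_all
  then show ?thesis unfolding power2_diff power2_abs abs_mult by linarith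
qed

lemma integrable_mult_of_squares:
  fixes f g :: "'a \<Rightarrow> real"
  assumes "f \<in> borel_measurable M" "g \<in> borel_measurable M"
    and "integrable M (\<lambda>x. (f x)\<^sup>2)" "integrable M (\<lambda>x. (g x)\<^sup>2)"
  shows "integrable M (\<lambda>x. f x * g x)"
proof (rule Bochner_Integration.integrable_bound)
  show "integrable M (\<lambda>x. (f x)\<^sup>2 + (g x)\<^sup>2)"
    using assms by simp
  show "AE x in M. norm (f x * g x) \<le> norm ((f x)\<^sup>2 + (g x)\<^sup>2)"
    using abs_mult_le_sum_squares by simp
qed (use assms in simp)

lemma integrable_of_square:
  fixes f :: "'a \<Rightarrow> real"
  assumes "prob_space M" "f \<in> borel_measurable M" "integrable M (\<lambda>x. (f x)\<^sup>2)"
  shows "integrable M f"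
proof -
  interpret prob_space M by fact
  show ?thesis
    using integrable_mult_of_squares[of f M "\<lambda>_. 1"] assms by simp
qed

lemma integrable_square_add:
  fixes f g :: "'a \<Rightarrow> real"
  assumes "f \<in> borel_measurable M" "g \<in> borel_measurable M"
    and "integrable M (\<lambda>x. (f x)\<^sup>2)" "integrable M (\<lambda>x. (g x)\<^sup>2)"
  shows "integrable M (\<lambda>x. (f x + g x)\<^sup>2)"
proof -
  have "integrable M (\<lambda>x. (f x)\<^sup>2 + (g x)\<^sup>2 + 2 * (f x * g x))"
    using assms integrable_mult_of_squares[OF assms]
    by (intro Bochner_Integration.integrable_add integrable_mult_right) simp_all
  then show ?thesis by (simp add: power2_sum mult.assoc)
qed

lemma integral_mult_eq_0_of_null:
  fixes f g :: "'a \<Rightarrow> real"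
  assumes "integrable M (\<lambda>x. (g x)\<^sup>2)" "(\<integral>x. (g x)\<^sup>2 \<partial>M) = 0"
  shows "(\<integral>x. f x * g x \<partial>M) = 0"
proof -
  have "AE x in M. (g x)\<^sup>2 = 0"
    using integral_nonneg_eq_0_iff_AE[OF assms(1)] assms(2) by simp
  then show ?thesis
    by (intro integral_eq_zero_AE) auto
qed

lemma integral_Cauchy_Schwarz:
  fixes f g :: "'a \<Rightarrow> real"
  assumes f: "f \<in> borel_measurable M" "integrable M (\<lambda>x. (f x)\<^sup>2)"
    and g: "g \<in> borel_measurable M" "integrable M (\<lambda>x. (g x)\<^sup>2)"
  shows "\<bar>\<integral>x. f x * g x \<partial>M\<bar> \<le> sqrt (\<integral>x. (f x)\<^sup>2 \<partial>M) * sqrt (\<integral>x. (g x)\<^sup>2 \<partial>M)"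
proof -
  define A B C where "A = (\<integral>x. (f x)\<^sup>2 \<partial>M)" and "B = (\<integral>x. f x * g x \<partial>M)"
    and "C = (\<integral>x. (g x)\<^sup>2 \<partial>M)"
  have fg: "integrable M (\<lambda>x. f x * g x)"
    using integrable_mult_of_squares f g by blast
  have "C \<ge> 0" unfolding C_def by simp
  have "B\<^sup>2 \<le> A * C"
  proof (cases "C = 0")
    case True
    then show ?thesis
      using integral_mult_eq_0_of_null[OF g(2), of f] by (simp add: B_def C_def)
  next
    case False
    with \<open>C \<ge> 0\<close> have "C > 0" by simp
    \<comment> \<open>\<open>t\<close> minimises the quadratic \<open>\<integral>(f - t g)\<^sup>2\<close>\<close>
    define t where "t = B / C"
    have "0 \<le> (\<integral>x. (f x - t * g x)\<^sup>2 \<partial>M)" by simp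
    also have "\<dots> = (\<integral>x. (f x)\<^sup>2 - 2 * t * (f x * g x) + t\<^sup>2 * (g x)\<^sup>2 \<partial>M)"
      by (intro Bochner_Integration.integral_cong) (auto simp: power2_eq_square algebra_simps)
    also have "\<dots> = A - 2 * t * B + t\<^sup>2 * C"
      unfolding A_def B_def C_def using f g fg by simp
    also have "\<dots> = A - B\<^sup>2 / C"
      using \<open>C > 0\<close> by (simp add: t_def field_simps power2_eq_square)
    finally show ?thesis using \<open>C > 0\<close> by (simp add: field_simps)
  qed
  then have "sqrt (B\<^sup>2) \<le> sqrt (A * C)" by (rule real_sqrt_le_mono)
  then show ?thesis by (simp add: A_def B_def C_def real_sqrt_mult)
qed

section \<open>Representing functionals by a degenerate inner product\<close>

text \<open>
  A polynomial may vanish almost everywhere without being zero, so the inner product \<open>b\<close> may be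
  degenerate. Gram--Schmidt survives this: a vector with \<open>b h h = 0\<close> is orthogonal to everything and
  killed by the functional, so it can be skipped. The functional is generalised in the induction, as
  the statement for \<open>S\<close> is needed both for \<open>l\<close> and for \<open>b a\<close>, the latter to project the new vector \<open>a\<close>
  to \<open>span S\<close>.
\<close>
lemma (in vector_space) degenerate_Riesz_span:
  assumes "finite S"
    and sym: "\<And>x y. b x y = b y x"
    and add: "\<And>x y z. x \<in> span S \<Longrightarrow> y \<in> span S \<Longrightarrow> z \<in> span S \<Longrightarrow> b x (y + z) = b x y + b x z"
    and bscale: "\<And>c x y. x \<in> span S \<Longrightarrow> y \<in> span S \<Longrightarrow> b x (scale c y) = c * b x y"
    and null: "\<And>x y. x \<in> span S \<Longrightarrow> y \<in> span S \<Longrightarrow> b y y = 0 \<Longrightarrow> b x y = 0"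
    and ladd: "\<And>x y. x \<in> span S \<Longrightarrow> y \<in> span S \<Longrightarrow> l (x + y) = l x + l y"
    and lscale: "\<And>c x. x \<in> span S \<Longrightarrow> l (scale c x) = c * l x"
    and lnull: "\<And>x. x \<in> span S \<Longrightarrow> b x x = 0 \<Longrightarrow> l x = 0"
  shows "\<exists>g\<in>span S. \<forall>x\<in>span S. l x = b g x"
  using assms
proof (induction S arbitrary: l rule: finite_induct)
  case empty
  have "l 0 = 0" "b 0 0 = 0"
    using empty.prems(6)[of 0 0] empty.prems(3)[of 0 0 0] by (simp_all add: span_zero)
  then show ?case by simp
next
  case (insert a S)
  note sym = insert.prems(1) and add = insert.prems(2) and bscale = insert.prems(3)
    and null = insert.prems(4) and ladd = insert.prems(5) and lscale = insert.prems(6)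
    and lnull = insert.prems(7)
  have sub: "x \<in> span (insert a S)" if "x \<in> span S" for x
    using that span_mono[of S "insert a S"] by blast
  have a: "a \<in> span (insert a S)" by (simp add: span_base)
  have rep: "\<exists>g\<in>span S. \<forall>x\<in>span S. m x = b g x"
    if "\<And>x y. x \<in> span (insert a S) \<Longrightarrow> y \<in> span (insert a S) \<Longrightarrow> m (x + y) = m x + m y"
      "\<And>c x. x \<in> span (insert a S) \<Longrightarrow> m (scale c x) = c * m x"
      "\<And>x. x \<in> span (insert a S) \<Longrightarrow> b x x = 0 \<Longrightarrow> m x = 0" for m
    by (rule insert.IH) (use sym in \<open>auto intro: add bscale null that sub\<close>)
  have "\<exists>p\<in>span S. \<forall>x\<in>span S. b a x = b p x"
    by (rule rep) (auto intro: add bscale null a)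
  then obtain p where p: "p \<in> span S" "\<And>x. x \<in> span S \<Longrightarrow> b a x = b p x" by blast
  obtain g0 where g0: "g0 \<in> span S" "\<And>x. x \<in> span S \<Longrightarrow> l x = b g0 x"
    using rep[of l] ladd lscale lnull by blast
  \<comment> \<open>one Gram--Schmidt step: \<open>h\<close> is the component of \<open>a\<close> orthogonal to \<open>span S\<close>\<close>
  define h where "h = a + scale (-1) p"
  have h: "h \<in> span (insert a S)"
    unfolding h_def by (intro span_add span_scale a sub p)
  have hS: "b h x = 0" if "x \<in> span S" for x
  proof -
    have "b x h = b x a + (-1) * b x p"
      unfolding h_def by (simp only: add bscale span_scale a sub that p(1))
    then show ?thesis using p(2)[OF that] sym by simp
  qed
  \<comment> \<open>if \<open>b h h = 0\<close>, then \<open>k = 0\<close> since division by zero gives zero, and nothing is added to \<open>g0\<close>\<close>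
  define k where "k = l h / b h h"
  have kh: "k * b h h = l h"
    using lnull[OF h] by (cases "b h h = 0") (auto simp: k_def)
  define g where "g = g0 + scale k h"
  have g: "g \<in> span (insert a S)"
    unfolding g_def by (intro span_add span_scale h sub g0)
  have "l x = b g x" if x: "x \<in> span (insert a S)" for x
  proof -
    obtain c where c: "x - scale c a \<in> span S" using x by (auto simp: span_insert)
    define s where "s = (x - scale c a) + scale c p"
    have s: "s \<in> span S" unfolding s_def by (intro span_add span_scale c p)
    have x_eq: "x = s + scale c h"
      by (simp add: s_def h_def scale_right_distrib scale_right_diff_distrib)
    have bg: "b g y = b g0 y + k * b h y" if y: "y \<in> span (insert a S)" for y
    proof -
      have "b y g = b y g0 + k * b y h"
        unfolding g_def by (simp only: add bscale span_scale h sub g0(1) y)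
      then show ?thesis using sym by simp
    qed
    have "b g x = b g s + c * b g h"
      unfolding x_eq by (simp only: add bscale span_scale h sub[OF s] g)
    also have "b g s = l s"
      using bg[OF sub[OF s]] hS[OF s] g0(2)[OF s] by simp
    also have "b g h = l h"
      using bg[OF h] hS[OF g0(1)] sym[of g0 h] kh by simp
    also have "l s + c * l h = l x"
      unfolding x_eq by (simp only: ladd lscale span_scale h sub[OF s])
    finally show ?thesis by simp
  qed
  with g show ?case by blast
qed

text \<open>
  Linearity is required on \<open>V\<close> only, because a form given by integrals is bilinear only where the
  integrals exist.
\<close>
lemma (in vector_space) degenerate_Riesz:
  assumes V: "subspace V" "finite T" "V \<subseteq> span T"
    and sym: "\<And>x y. b x y = b y x"
    and add: "\<And>x y z. x \<in> V \<Longrightarrow> y \<in> V \<Longrightarrow> z \<in> V \<Longrightarrow> b x (y + z) = b x y + b x z"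
    and bscale: "\<And>c x y. x \<in> V \<Longrightarrow> y \<in> V \<Longrightarrow> b x (scale c y) = c * b x y"
    and null: "\<And>x y. x \<in> V \<Longrightarrow> y \<in> V \<Longrightarrow> b y y = 0 \<Longrightarrow> b x y = 0"
    and ladd: "\<And>x y. x \<in> V \<Longrightarrow> y \<in> V \<Longrightarrow> l (x + y) = l x + l y"
    and lscale: "\<And>c x. x \<in> V \<Longrightarrow> l (scale c x) = c * l x"
    and lnull: "\<And>x. x \<in> V \<Longrightarrow> b x x = 0 \<Longrightarrow> l x = 0"
  shows "\<exists>g\<in>V. \<forall>x\<in>V. l x = b g x"
proof -
  obtain B where B: "B \<subseteq> V" "independent B" "V \<subseteq> span B"
    using maximal_independent_subset[of V] by blast
  have "span B = V"
    using B(3) span_minimal[OF B(1) V(1)] by (rule subset_antisym[rotated])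
  note Riesz = degenerate_Riesz_span[of B b l, unfolded this]
  have "finite B"
    using independent_span_bound[OF V(2) B(2)] B(1) V(3) by blast
  show ?thesis
    by (rule Riesz) fact+
qed

section \<open>The low-degree projection of the likelihood ratio\<close>

interpretation pointwise: vector_space "\<lambda>(c :: real) f x. c * f x :: real"
  by unfold_locales (auto simp: algebra_simps fun_eq_iff)

lemma polysI: "(\<lambda>x. \<Sum>\<alpha>\<in>multi_indices N D. c \<alpha> * (\<Prod>i<N. x i ^ \<alpha> i)) \<in> polys N D"
  unfolding polys_def by (rule CollectI, rule exI, rule refl)

lemma polys_add: "f \<in> polys N D \<Longrightarrow> g \<in> polys N D \<Longrightarrow> f + g \<in> polys N D"
proof -
  assume "f \<in> polys N D" "g \<in> polys N D"
  then obtain c d where "f = (\<lambda>x. \<Sum>\<alpha>\<in>multi_indices N D. c \<alpha> * (\<Prod>i<N. x i ^ \<alpha> i))"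
    "g = (\<lambda>x. \<Sum>\<alpha>\<in>multi_indices N D. d \<alpha> * (\<Prod>i<N. x i ^ \<alpha> i))"
    by (auto simp: polys_def)
  then have "f + g = (\<lambda>x. \<Sum>\<alpha>\<in>multi_indices N D. (c \<alpha> + d \<alpha>) * (\<Prod>i<N. x i ^ \<alpha> i))"
    by (simp add: fun_eq_iff sum.distrib distrib_right)
  then show ?thesis by (simp only: polysI)
qed

lemma polys_scale: "f \<in> polys N D \<Longrightarrow> (\<lambda>x. k * f x) \<in> polys N D"
proof -
  assume "f \<in> polys N D"
  then obtain c where "f = (\<lambda>x. \<Sum>\<alpha>\<in>multi_indices N D. c \<alpha> * (\<Prod>i<N. x i ^ \<alpha> i))"
    by (auto simp: polys_def)
  then have "(\<lambda>x. k * f x) = (\<lambda>x. \<Sum>\<alpha>\<in>multi_indices N D. (k * c \<alpha>) * (\<Prod>i<N. x i ^ \<alpha> i))"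
    by (simp add: fun_eq_iff sum_distrib_left mult.assoc)
  then show ?thesis by (simp only: polysI)
qed

lemma const_one_in_polys: "(\<lambda>_. 1) \<in> polys N D"
proof -
  define z :: "nat \<Rightarrow> nat" where "z = (\<lambda>i\<in>{..<N}. 0)"
  have z: "z \<in> multi_indices N D" by (auto simp: z_def multi_indices_def)
  have "(\<lambda>x. 1 :: real) = (\<lambda>x. \<Sum>\<alpha>\<in>multi_indices N D. (if \<alpha> = z then 1 else 0) * (\<Prod>i<N. x i ^ \<alpha> i))"
  proof
    fix x :: "nat \<Rightarrow> real"
    have "(\<Sum>\<alpha>\<in>multi_indices N D. (if \<alpha> = z then 1 else 0) * (\<Prod>i<N. x i ^ \<alpha> i))
        = (\<Sum>\<alpha>\<in>multi_indices N D. if \<alpha> = z then (\<Prod>i<N. x i ^ \<alpha> i) else 0)"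
      by (intro sum.cong) auto
    also have "\<dots> = (\<Prod>i<N. x i ^ z i)"
      using z finite_multi_indices by (simp add: sum.delta)
    also have "\<dots> = 1" by (intro prod.neutral) (simp add: z_def)
    finally show "1 = (\<Sum>\<alpha>\<in>multi_indices N D. (if \<alpha> = z then 1 else 0) * (\<Prod>i<N. x i ^ \<alpha> i))" by simp
  qed
  then show ?thesis by (simp only: polysI)
qed

lemma polys_finite_dim: "\<exists>T. finite T \<and> polys N D \<subseteq> pointwise.span T"
proof (intro exI conjI subsetI)
  let ?T = "(\<lambda>\<alpha> x. \<Prod>i<N. x i ^ \<alpha> i) ` multi_indices N D :: ((nat \<Rightarrow> real) \<Rightarrow> real) set"
  show "finite ?T" using finite_multi_indices by simp
  fix f assume "f \<in> polys N D"
  then obtain c where f: "f = (\<lambda>x. \<Sum>\<alpha>\<in>multi_indices N D. c \<alpha> * (\<Prod>i<N. x i ^ \<alpha> i))"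
    by (auto simp: polys_def)
  have sum_apply: "(\<Sum>\<alpha>\<in>A. F \<alpha>) x = (\<Sum>\<alpha>\<in>A. F \<alpha> x)"
    for A :: "(nat \<Rightarrow> nat) set" and F :: "_ \<Rightarrow> (nat \<Rightarrow> real) \<Rightarrow> real" and x
    by (induction A rule: infinite_finite_induct) auto
  have "f = (\<Sum>\<alpha>\<in>multi_indices N D. (\<lambda>x. c \<alpha> * (\<Prod>i<N. x i ^ \<alpha> i)))"
    by (simp add: f fun_eq_iff sum_apply)
  also have "\<dots> \<in> pointwise.span ?T"
    by (intro pointwise.span_sum pointwise.span_scale pointwise.span_base imageI)
  finally show "f \<in> pointwise.span ?T" .
qed

lemma polys_measurable_distribution:
  assumes "distribution_on N M" "f \<in> polys N D"
  shows "f \<in> borel_measurable M"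
  using polys_measurable[OF assms(2)] assms(1)
  by (simp add: distribution_on_def cong: measurable_cong_sets)

context
  fixes N D :: nat and P Q :: "(nat \<Rightarrow> real) measure"
  assumes P: "distribution_on N P" and Q: "distribution_on N Q"
    and ac: "absolutely_continuous Q P"
begin

interpretation P: prob_space P using P by (simp add: distribution_on_def)
interpretation Q: prob_space Q using Q by (simp add: distribution_on_def)

private abbreviation "L \<equiv> likelihood_ratio Q P"
private abbreviation "V \<equiv> low_degree_space N D Q L"

private lemmas polys_measurable_PQ =
  polys_measurable_distribution[OF P] polys_measurable_distribution[OF Q]

text \<open>
  The first part replaces the integrability of \<open>L f\<close> in the definition of the low-degree space by
  \<open>P\<close>-integrability, from which closure under sums and the membership of tests with \<open>E\<^sub>P f\<^sup>2 < \<infinity>\<close> are evident.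
\<close>
lemma change_of_measure:
  assumes "f \<in> polys N D"
  shows "integrable P f \<longleftrightarrow> integrable Q (\<lambda>x. L x * f x)"
    and "(\<integral>x. f x \<partial>P) = (\<integral>x. L x * f x \<partial>Q)"
proof -
  have "sets P = sets Q" using P Q by (simp add: distribution_on_def)
  then show "integrable P f \<longleftrightarrow> integrable Q (\<lambda>x. L x * f x)"
    "(\<integral>x. f x \<partial>P) = (\<integral>x. L x * f x \<partial>Q)"
    unfolding likelihood_ratio_def
    using Q.RN_deriv_integrable[OF P.sigma_finite_measure_axioms ac _ polys_measurable_PQ(2)[OF assms]]
      Q.RN_deriv_integral[OF P.sigma_finite_measure_axioms ac _ polys_measurable_PQ(2)[OF assms]]
    by auto
qed

lemma low_degree_space_iff:
  "f \<in> V \<longleftrightarrow> f \<in> polys N D \<and> integrable Q (\<lambda>x. (f x)\<^sup>2) \<and> integrable P f"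
  using change_of_measure(1) by (auto simp: low_degree_space_def)

lemma low_degree_space_subspace: "pointwise.subspace V"
proof (rule pointwise.subspaceI)
  show scale: "(\<lambda>x. c * f x) \<in> V" if "f \<in> V" for c f
    using that polys_scale by (auto simp: low_degree_space_iff power_mult_distrib)
  have "(\<lambda>_. 1) \<in> V"
    by (simp add: low_degree_space_iff const_one_in_polys)
  from scale[OF this, of 0] show "0 \<in> V"
    by (simp add: zero_fun_def)
  show "f + g \<in> V" if f: "f \<in> V" and g: "g \<in> V" for f g
    using f g polys_add[of f N D g] integrable_square_add[of f Q g] polys_measurable_PQ
    by (auto simp: low_degree_space_iff plus_fun_def)
qed

lemma exists_low_degree_proj:
  "\<exists>g\<in>V. \<forall>f\<in>V. (\<integral>x. f x \<partial>P) = L2_inner Q g f"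
proof -
  obtain T where T: "finite T" "polys N D \<subseteq> pointwise.span T"
    using polys_finite_dim by blast
  have sq: "integrable Q (\<lambda>x. (f x)\<^sup>2)" and ms: "f \<in> borel_measurable Q" "f \<in> borel_measurable P"
    and intP: "integrable P f" if "f \<in> V" for f
    using that polys_measurable_PQ by (auto simp: low_degree_space_iff)
  have prod: "integrable Q (\<lambda>x. f x * g x)" if "f \<in> V" "g \<in> V" for f g
    using that integrable_mult_of_squares[of f Q g] sq ms by blast
  show ?thesis
  proof (rule pointwise.degenerate_Riesz[OF low_degree_space_subspace T(1)])
    show "V \<subseteq> pointwise.span T" using T(2) by (auto simp: low_degree_space_def)
    show "L2_inner Q f g = L2_inner Q g f" for f g by (simp add: L2_inner_def mult.commute)
    show "L2_inner Q f (g + h) = L2_inner Q f g + L2_inner Q f h" if "f \<in> V" "g \<in> V" "h \<in> V" for f g h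
      using prod that by (simp add: L2_inner_def distrib_left)
    show "L2_inner Q f (\<lambda>x. c * g x) = c * L2_inner Q f g" if "f \<in> V" "g \<in> V" for c f g
      by (simp add: L2_inner_def mult.left_commute)
    show "L2_inner Q f g = 0" if "f \<in> V" "g \<in> V" "L2_inner Q g g = 0" for f g
      using integral_mult_eq_0_of_null[OF sq] that by (simp add: L2_inner_def power2_eq_square)
    show "(\<integral>x. (f + g) x \<partial>P) = (\<integral>x. f x \<partial>P) + (\<integral>x. g x \<partial>P)" if "f \<in> V" "g \<in> V" for f g
      using intP that by simp
    show "(\<integral>x. c * f x \<partial>P) = c * (\<integral>x. f x \<partial>P)" if "f \<in> V" for c f by simp
    show "(\<integral>x. f x \<partial>P) = 0" if f: "f \<in> V" and "L2_inner Q f f = 0" for f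
      using integral_mult_eq_0_of_null[OF sq[OF f], of L] that change_of_measure(2)[of f]
      by (simp add: L2_inner_def power2_eq_square low_degree_space_def)
  qed
qed

text \<open>
  Orthogonality of \<open>L - g\<close> to \<open>f\<close> says that \<open>g\<close> represents \<open>f \<mapsto> E\<^sub>P f\<close>; hence a projection exists and
  the choice operator in its definition returns one.
\<close>
lemma low_degree_proj:
  shows "low_degree_proj N D Q L \<in> V"
    and "f \<in> V \<Longrightarrow> (\<integral>x. f x \<partial>P) = L2_inner Q (low_degree_proj N D Q L) f"
proof -
  have orth: "L2_inner Q (\<lambda>x. L x - g x) f = 0 \<longleftrightarrow> (\<integral>x. f x \<partial>P) = L2_inner Q g f"
    if f: "f \<in> V" and g: "g \<in> V" for f g
  proof -
    have "integrable Q (\<lambda>x. g x * f x)" "integrable Q (\<lambda>x. L x * f x)" "f \<in> polys N D"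
      using f g integrable_mult_of_squares[of g Q f] polys_measurable_PQ
      by (auto simp: low_degree_space_def)
    then show ?thesis
      by (simp add: L2_inner_def left_diff_distrib change_of_measure(2))
  qed
  have "\<exists>g. g \<in> V \<and> (\<forall>f\<in>V. L2_inner Q (\<lambda>x. L x - g x) f = 0)"
    using exists_low_degree_proj orth by blast
  from someI_ex[OF this] have
    "low_degree_proj N D Q L \<in> V \<and> (\<forall>f\<in>V. L2_inner Q (\<lambda>x. L x - low_degree_proj N D Q L x) f = 0)"
    unfolding low_degree_proj_def .
  then show "low_degree_proj N D Q L \<in> V"
    "f \<in> V \<Longrightarrow> (\<integral>x. f x \<partial>P) = L2_inner Q (low_degree_proj N D Q L) f"
    using orth by auto
qed

text \<open>
  The gap between the two means of \<open>f\<close> is the inner product of \<open>f\<close> with \<open>L\<^sup>\<le>\<^sup>D - 1\<close>. Since \<open>1\<close> is the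
  projection of \<open>L\<close> onto the constants, Pythagoras gives \<open>\<parallel>L\<^sup>\<le>\<^sup>D - 1\<parallel>\<^sup>2 = \<parallel>L\<^sup>\<le>\<^sup>D\<parallel>\<^sup>2 - 1\<close>.
\<close>
lemma low_degree_advantage:
  assumes f: "f \<in> V" and K: "(\<integral>x. (f x)\<^sup>2 \<partial>Q) \<le> K"
  shows "(\<integral>x. f x \<partial>P) - (\<integral>x. f x \<partial>Q) \<le> sqrt K * sqrt ((low_degree_norm N D Q P)\<^sup>2 - 1)"
proof -
  define g where "g = low_degree_proj N D Q L"
  have g: "g \<in> V" and rep: "\<And>f. f \<in> V \<Longrightarrow> (\<integral>x. f x \<partial>P) = (\<integral>x. g x * f x \<partial>Q)"
    using low_degree_proj by (auto simp: g_def L2_inner_def)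
  have ms: "f \<in> borel_measurable Q" "g \<in> borel_measurable Q"
    and sq: "integrable Q (\<lambda>x. (f x)\<^sup>2)" "integrable Q (\<lambda>x. (g x)\<^sup>2)"
    using f g polys_measurable_PQ by (auto simp: low_degree_space_def)
  note int = integrable_of_square[OF Q.prob_space_axioms ms(1) sq(1)]
    integrable_of_square[OF Q.prob_space_axioms ms(2) sq(2)]
    integrable_mult_of_squares[OF ms(2) ms(1) sq(2) sq(1)]
  have "(\<lambda>_. 1) \<in> V"
    by (simp add: low_degree_space_iff const_one_in_polys)
  from rep[OF this] have g1: "(\<integral>x. g x \<partial>Q) = 1"
    by (simp add: P.prob_space)
  have norm: "(low_degree_norm N D Q P)\<^sup>2 = (\<integral>x. (g x)\<^sup>2 \<partial>Q)"
    by (simp add: low_degree_norm_def L2_norm_def L2_inner_def g_def power2_eq_square)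
  have sq1: "(\<lambda>x. (g x - 1)\<^sup>2) = (\<lambda>x. (g x)\<^sup>2 - 2 * g x + 1)"
    by (simp add: fun_eq_iff power2_eq_square algebra_simps)
  have "(\<integral>x. f x \<partial>P) - (\<integral>x. f x \<partial>Q) = (\<integral>x. (g x - 1) * f x \<partial>Q)"
    using rep[OF f] int by (simp add: left_diff_distrib)
  also have "\<dots> \<le> \<bar>\<integral>x. (g x - 1) * f x \<partial>Q\<bar>" by simp
  also have "\<dots> \<le> sqrt (\<integral>x. (g x - 1)\<^sup>2 \<partial>Q) * sqrt (\<integral>x. (f x)\<^sup>2 \<partial>Q)"
    using ms sq int by (intro integral_Cauchy_Schwarz) (auto simp: sq1)
  also have "\<dots> \<le> sqrt (\<integral>x. (g x - 1)\<^sup>2 \<partial>Q) * sqrt K"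
    using K by (intro mult_left_mono) auto
  also have "(\<integral>x. (g x - 1)\<^sup>2 \<partial>Q) = (low_degree_norm N D Q P)\<^sup>2 - 1"
    unfolding sq1 norm using sq int g1 by (simp add: Q.prob_space)
  finally show ?thesis by (simp add: mult.commute)
qed

end

section \<open>Failure probabilities\<close>

text \<open>
  The output law is a monadic bind, whose value on a set is the averaged kernel only if the kernel is
  measurable; that follows from writing the kernel of \<open>test_of f\<close> explicitly as a function of \<open>f x\<close>.
\<close>
lemma output_law_test_of:
  assumes "prob_space M" and f[measurable]: "f \<in> borel_measurable M"
  shows "measure (output_law M (test_of f)) A = (\<integral>x. measure_pmf.prob (test_of f x) A \<partial>M)"
proof -
  interpret prob_space M by fact
  have "(\<lambda>x. measure_pmf (test_of f x)) \<in> measurable M (subprob_algebra (count_space UNIV))"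
  proof (rule measurable_subprob_algebra)
    fix A :: "bool option set"
    have "(\<lambda>x. emeasure (measure_pmf (test_of f x)) A)
      = (\<lambda>x. ennreal (if f x \<in> {0..1} then (if Some True \<in> A then f x else 0)
           + (if Some False \<in> A then 1 - f x else 0) else indicator A None))"
    proof
      fix x
      show "emeasure (measure_pmf (test_of f x)) A
        = ennreal (if f x \<in> {0..1} then (if Some True \<in> A then f x else 0)
           + (if Some False \<in> A then 1 - f x else 0) else indicator A None)"
      proof (cases "f x \<in> {0..1}")
        case True
        have "measure_pmf.prob (bernoulli_pmf (f x)) (Some -` A)
          = (\<Sum>b\<in>Some -` A. pmf (bernoulli_pmf (f x)) b)"
          by (simp add: measure_measure_pmf_finite)
        also have "\<dots> = (\<Sum>b\<in>UNIV. if b \<in> Some -` A then pmf (bernoulli_pmf (f x)) b else 0)"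
          by (simp add: sum.If_cases Int_def vimage_def)
        also have "\<dots> = (if Some True \<in> A then f x else 0) + (if Some False \<in> A then 1 - f x else 0)"
          using True by (simp add: UNIV_bool)
        finally show ?thesis
          using True by (simp add: test_of_def measure_pmf.emeasure_eq_measure)
      next
        case False
        then show ?thesis by (auto simp: test_of_def measure_pmf.emeasure_eq_measure)
      qed
    qed
    then show "(\<lambda>x. emeasure (measure_pmf (test_of f x)) A) \<in> borel_measurable M"
      by simp
  qed (auto intro: prob_space_imp_subprob_space measure_pmf.prob_space_axioms)
  then show ?thesis
    unfolding output_law_def by (rule measure_bind) simp
qed

lemma fails_test_of:
  assumes "prob_space M" and f: "f \<in> borel_measurable M"
  shows "fails_null M (test_of f) = (\<integral>x. (if f x \<in> {0..1} then f x else 1) \<partial>M)"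
    and "fails_alt M (test_of f) = (\<integral>x. (if f x \<in> {0..1} then 1 - f x else 1) \<partial>M)"
proof -
  have "measure_pmf.prob (bernoulli_pmf p) (Some -` {Some True, None}) = p"
    "measure_pmf.prob (bernoulli_pmf p) (Some -` {Some False, None}) = 1 - p" if "p \<in> {0..1}" for p
  proof -
    have "Some -` {Some True, None} = {True}" "Some -` {Some False, None} = {False}" by auto
    with that show "measure_pmf.prob (bernoulli_pmf p) (Some -` {Some True, None}) = p"
      "measure_pmf.prob (bernoulli_pmf p) (Some -` {Some False, None}) = 1 - p"
      by (simp_all add: measure_pmf_single)
  qed
  then show "fails_null M (test_of f) = (\<integral>x. (if f x \<in> {0..1} then f x else 1) \<partial>M)"
    "fails_alt M (test_of f) = (\<integral>x. (if f x \<in> {0..1} then 1 - f x else 1) \<partial>M)"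
    unfolding fails_null_def fails_alt_def output_law_test_of[OF assms]
    by (auto intro!: Bochner_Integration.integral_cong simp: test_of_def)
qed

text \<open>
  The values of \<open>f\<close> in \<open>B\<close> may be arbitrarily large; what the rare event contributes to the mean is
  controlled by pairing \<open>f\<close> with the indicator of that event.
\<close>
lemma integral_outside_le:
  fixes f :: "'a \<Rightarrow> real"
  assumes "prob_space M" and f[measurable]: "f \<in> borel_measurable M"
    and sq: "integrable M (\<lambda>x. (f x)\<^sup>2)" and [measurable]: "B \<in> sets borel"
    and K: "(\<integral>x. (f x)\<^sup>2 \<partial>M) \<le> K" and \<tau>: "measure M {x \<in> space M. f x \<in> B} \<le> \<tau>"
  shows "\<bar>\<integral>x. f x * indicator {x \<in> space M. f x \<in> B} x \<partial>M\<bar> \<le> sqrt K * sqrt \<tau>"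
proof -
  interpret prob_space M by fact
  let ?I = "indicator {x \<in> space M. f x \<in> B} :: 'a \<Rightarrow> real"
  \<comment> \<open>so the \<open>L\<^sup>2\<close> norm of \<open>?I\<close> is the root of the probability of \<open>f \<in> B\<close>\<close>
  have I: "(\<lambda>x. (?I x)\<^sup>2) = ?I" by (auto simp: fun_eq_iff indicator_def)
  have "\<bar>\<integral>x. f x * ?I x \<partial>M\<bar> \<le> sqrt (\<integral>x. (f x)\<^sup>2 \<partial>M) * sqrt (\<integral>x. (?I x)\<^sup>2 \<partial>M)"
    by (rule integral_Cauchy_Schwarz)
      (auto simp: I sq integrable_indicator_iff emeasure_eq_measure)
  also have "\<dots> \<le> sqrt K * sqrt \<tau>"
    unfolding I using K \<tau> by (intro mult_mono) (auto intro: order_trans[OF _ K])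
  finally show ?thesis .
qed

lemma low_degree_tests_fail:
  assumes P: "distribution_on N P" and Q: "distribution_on N Q"
    and ac: "absolutely_continuous Q P"
    and \<Psi>: "\<Psi> \<in> low_degree_tests N Q P \<tau> D K"
  shows "fails_null Q \<Psi> + fails_alt P \<Psi>
    \<ge> 1 - sqrt K * sqrt ((low_degree_norm N D Q P)\<^sup>2 - 1) - (sqrt \<tau> + 2 * sqrt K) * sqrt \<tau>"
proof -
  interpret P: prob_space P using P by (simp add: distribution_on_def)
  interpret Q: prob_space Q using Q by (simp add: distribution_on_def)
  obtain f where \<Psi>_eq: "\<Psi> = test_of f" and f: "f \<in> polys N D"
    and sq: "integrable Q (\<lambda>x. (f x)\<^sup>2)" "integrable P (\<lambda>x. (f x)\<^sup>2)"
    and K: "(\<integral>x. (f x)\<^sup>2 \<partial>Q) \<le> K" "(\<integral>x. (f x)\<^sup>2 \<partial>P) \<le> K"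
    and \<tau>: "measure Q {x \<in> space Q. f x \<in> - {0..1}} \<le> \<tau>" "measure P {x \<in> space P. f x \<in> - {0..1}} \<le> \<tau>"
    using \<Psi> by (auto simp: low_degree_tests_def)
  note ms[measurable] = polys_measurable_distribution[OF P f] polys_measurable_distribution[OF Q f]
  have int: "integrable P f" "integrable Q f"
    by (rule integrable_of_square[OF P.prob_space_axioms ms(1) sq(2)]
        integrable_of_square[OF Q.prob_space_axioms ms(2) sq(1)])+
  \<comment> \<open>one event for each measure, as \<open>space P\<close> and \<open>space Q\<close> are not syntactically equal\<close>
  define A B where "A = {x \<in> space Q. f x \<in> - {0..1}}" and "B = {x \<in> space P. f x \<in> - {0..1}}"
  have [measurable]: "A \<in> sets Q" "B \<in> sets P" unfolding A_def B_def by measurable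
  have intI: "integrable Q (\<lambda>x. f x * indicator A x)" "integrable P (\<lambda>x. f x * indicator B x)"
    using int by (auto intro: integrable_real_mult_indicator)
  have IA: "integrable Q (indicator A :: _ \<Rightarrow> real)" 
    by (simp add: integrable_indicator_iff Q.emeasure_eq_measure)
  have out: "\<bar>\<integral>x. f x * indicator A x \<partial>Q\<bar> \<le> sqrt K * sqrt \<tau>"
    "\<bar>\<integral>x. f x * indicator B x \<partial>P\<bar> \<le> sqrt K * sqrt \<tau>"
    unfolding A_def B_def
    by (rule integral_outside_le[OF Q.prob_space_axioms ms(2) sq(1) _ K(1) \<tau>(1)], simp)
      (rule integral_outside_le[OF P.prob_space_axioms ms(1) sq(2) _ K(2) \<tau>(2)], simp)
  have "fails_null Q \<Psi> = (\<integral>x. f x - f x * indicator A x + indicator A x \<partial>Q)"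
    unfolding \<Psi>_eq by (subst fails_test_of(1)[OF Q.prob_space_axioms])
      (auto intro!: Bochner_Integration.integral_cong simp: A_def indicator_def)
  also have "\<dots> = (\<integral>x. f x \<partial>Q) - (\<integral>x. f x * indicator A x \<partial>Q) + measure Q A"
    using int intI IA by simp
  finally have null: "fails_null Q \<Psi> = \<dots>" .
  have "fails_alt P \<Psi> = (\<integral>x. 1 - f x + f x * indicator B x \<partial>P)"
    unfolding \<Psi>_eq by (subst fails_test_of(2)[OF P.prob_space_axioms])
      (auto intro!: Bochner_Integration.integral_cong simp: B_def indicator_def)
  also have "\<dots> = 1 - (\<integral>x. f x \<partial>P) + (\<integral>x. f x * indicator B x \<partial>P)"
    using int intI by (simp add: P.prob_space)
  finally have alt: "fails_alt P \<Psi> = \<dots>" .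
  let ?s = "sqrt ((low_degree_norm N D Q P)\<^sup>2 - 1)"
  have V: "f \<in> low_degree_space N D Q (likelihood_ratio Q P)"
    using low_degree_space_iff[OF P Q ac] f sq int by blast
  have adv: "(\<integral>x. f x \<partial>P) - (\<integral>x. f x \<partial>Q) \<le> sqrt K * ?s"
    by (rule low_degree_advantage[OF P Q ac V K(1)])
  have "\<tau> \<ge> 0" using \<tau>(1) measure_nonneg order_trans by blast
  then have rhs: "(sqrt \<tau> + 2 * sqrt K) * sqrt \<tau> = \<tau> + 2 * (sqrt K * sqrt \<tau>)"
    by (simp add: distrib_right)
  have "measure Q A \<ge> 0" by simp
  with \<open>\<tau> \<ge> 0\<close> null alt adv out show ?thesis
    unfolding rhs abs_le_iff by linarith
qed

theorem lemma2p1: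
  shows "(\<forall>(N :: nat) (D :: nat) (\<tau> :: real) (K :: real) P Q \<Psi>.
            distribution_on N P \<and> distribution_on N Q \<and> absolutely_continuous Q P \<and>
            \<Psi> \<in> low_degree_tests N Q P \<tau> D K \<longrightarrow>
            fails_null Q \<Psi> + fails_alt P \<Psi> \<ge>
              1 - sqrt K * sqrt ((low_degree_norm N D Q P)\<^sup>2 - 1)
                - (sqrt \<tau> + 2 * sqrt K) * sqrt \<tau>)
       \<and>
         (\<forall>(N :: nat \<Rightarrow> nat) (D :: nat \<Rightarrow> nat) (\<tau> :: nat \<Rightarrow> real) (K :: nat \<Rightarrow> real) P Q \<Psi>.
            (\<forall>n. distribution_on (N n) (P n) \<and> distribution_on (N n) (Q n) \<and>
                 absolutely_continuous (Q n) (P n) \<and>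
                 \<Psi> n \<in> low_degree_tests (N n) (Q n) (P n) (\<tau> n) (D n) (K n)) \<and>
            (\<lambda>n. low_degree_norm (N n) (D n) (Q n) (P n) - 1) \<in> o(\<lambda>_. 1) \<and>
            \<tau> \<in> o(\<lambda>_. 1) \<and> K \<in> O(\<lambda>_. 1) \<longrightarrow>
            (\<exists>\<epsilon> :: nat \<Rightarrow> real. \<epsilon> \<in> o(\<lambda>_. 1) \<and>
               (\<forall>n. fails_null (Q n) (\<Psi> n) + fails_alt (P n) (\<Psi> n) \<ge> 1 - \<epsilon> n)))"
proof (intro conjI allI impI; elim conjE)
  fix N D :: nat and \<tau> K :: real and P Q :: "(nat \<Rightarrow> real) measure" and \<Psi>
  assume "distribution_on N P" "distribution_on N Q" "absolutely_continuous Q P"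
    "\<Psi> \<in> low_degree_tests N Q P \<tau> D K"
  then show "fails_null Q \<Psi> + fails_alt P \<Psi>
    \<ge> 1 - sqrt K * sqrt ((low_degree_norm N D Q P)\<^sup>2 - 1) - (sqrt \<tau> + 2 * sqrt K) * sqrt \<tau>"
    by (rule low_degree_tests_fail)
next
  fix N D :: "nat \<Rightarrow> nat" and \<tau> K :: "nat \<Rightarrow> real"
    and P Q :: "nat \<Rightarrow> (nat \<Rightarrow> real) measure" and \<Psi> :: "nat \<Rightarrow> rtest"
  assume tests: "\<forall>n. distribution_on (N n) (P n) \<and> distribution_on (N n) (Q n) \<and>
                 absolutely_continuous (Q n) (P n) \<and>
                 \<Psi> n \<in> low_degree_tests (N n) (Q n) (P n) (\<tau> n) (D n) (K n)"
    and norm: "(\<lambda>n. low_degree_norm (N n) (D n) (Q n) (P n) - 1) \<in> o(\<lambda>_. 1)"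
    and \<tau>: "\<tau> \<in> o(\<lambda>_. 1)" and K: "K \<in> O(\<lambda>_. 1)"
  define s where "s = (\<lambda>n. sqrt ((low_degree_norm (N n) (D n) (Q n) (P n))\<^sup>2 - 1))"
  define t where "t = (\<lambda>n. sqrt (\<tau> n))"
  define k where "k = (\<lambda>n. sqrt (K n))"
  \<comment> \<open>the error terms of the non-asymptotic bound\<close>
  define \<epsilon> where "\<epsilon> = (\<lambda>n. k n * s n + (t n + 2 * k n) * t n)"
  have "(\<lambda>n. low_degree_norm (N n) (D n) (Q n) (P n) - 1) \<longlonglongrightarrow> 0"
    using norm by (rule smalloD_tendsto[where g = "\<lambda>_. 1", simplified])
  then have "(\<lambda>n. low_degree_norm (N n) (D n) (Q n) (P n)) \<longlonglongrightarrow> 1"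
    by (simp add: LIM_zero_iff)
  then have "s \<longlonglongrightarrow> sqrt (1\<^sup>2 - 1)"
    unfolding s_def by (intro tendsto_intros)
  then have s: "s \<in> o(\<lambda>_. 1)" by (intro smalloI_tendsto) simp_all
  have "\<tau> \<longlonglongrightarrow> 0"
    using \<tau> by (rule smalloD_tendsto[where g = "\<lambda>_. 1", simplified])
  then have "t \<longlonglongrightarrow> sqrt 0"
    unfolding t_def by (intro tendsto_intros)
  then have t: "t \<in> o(\<lambda>_. 1)" by (intro smalloI_tendsto) simp_all
  obtain c where "eventually (\<lambda>n. norm (K n) \<le> c * norm (1 :: real)) sequentially"
    using K by (rule landau_o.bigE)
  moreover have "\<bar>sqrt y\<bar> \<le> sqrt c" if "\<bar>y\<bar> \<le> c" for y :: real
  proof -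
    have "\<bar>sqrt y\<bar> = sqrt \<bar>y\<bar>"
      by (cases "y \<ge> 0") (simp_all add: real_sqrt_minus)
    with that show ?thesis by simp
  qed
  ultimately have "eventually (\<lambda>n. norm (k n) \<le> sqrt c * norm (1 :: real)) sequentially"
    by (auto simp: k_def elim!: eventually_mono)
  then have k: "k \<in> O(\<lambda>_. 1)" by (rule bigoI)
  have "\<epsilon> \<in> o(\<lambda>_. 1 * 1)"
    unfolding \<epsilon>_def
    using k s t by (intro sum_in_smallo landau_o.big_small_mult sum_in_bigo)
      (auto intro: landau_o.small_imp_big)
  then have "\<epsilon> \<in> o(\<lambda>_. 1)" by simp
  moreover have "fails_null (Q n) (\<Psi> n) + fails_alt (P n) (\<Psi> n) \<ge> 1 - \<epsilon> n" for n
    using low_degree_tests_fail[of "N n" "P n" "Q n" "\<Psi> n" "\<tau> n" "D n" "K n"] tests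
    by (simp add: \<epsilon>_def s_def t_def k_def)
  ultimately show "\<exists>\<epsilon> :: nat \<Rightarrow> real. \<epsilon> \<in> o(\<lambda>_. 1) \<and>
      (\<forall>n. fails_null (Q n) (\<Psi> n) + fails_alt (P n) (\<Psi> n) \<ge> 1 - \<epsilon> n)"
    by blast
qed

end
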